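(* Let $k\geq 2$ be an integer and let $n=2^{k+2}-8$. For $r\in\{1,\ldots,n\}$ let $X_r$ denote the graph with vertex set $\{0,1\}^n$ in which two binary words are adjacent if and only if they differ in exactly $r$ coordinates. Then each of the graphs $X_{2^{k+1}-7}$, $X_{2^{k+1}-5}$, $X_{2^{k+1}-3}$ and $X_{2^{k+1}-1}$ admits instantaneous uniform mixing at time $\pi/2^{k}$.
   Context: For a graph $X$ with adjacency matrix $A(X)$, the continuous-time quantum walk is given by $U(t)=e^{-itA(X)}$. The walk on $X$ is said to be instantaneous uniform mixing at time $\tau$ if $|e^{-i\tau A(X)}_{a,b}|=1/\sqrt{|V(X)|}$ for all vertices $a,b$ of $X$. *)

theory Defs
  imports "HOL-Analysis.Analysis"
begin

text \<open>
  A simple graph on the vertex set \<^term>\<open>UNIV :: 'v set\<close> of a finite type is given by its adjacency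
  relation, which has to be symmetric and irreflexive.
\<close>

definition simple_graph :: "('v::finite \<Rightarrow> 'v \<Rightarrow> bool) \<Rightarrow> bool" where
  "simple_graph X \<longleftrightarrow> symp X \<and> irreflp X"

definition adjacency_matrix :: "('v::finite \<Rightarrow> 'v \<Rightarrow> bool) \<Rightarrow> complex^'v^'v" where
  "adjacency_matrix X = (\<chi> a b. if X a b then 1 else 0)"

text \<open>
  On square matrices the class operations \<^term>\<open>(*)\<close> and \<^term>\<open>(^)\<close> act entrywise, so the powers in
  the exponential series are formed with the matrix product \<^term>\<open>(**)\<close>.
\<close>

primrec matrix_power :: "complex^'v^'v \<Rightarrow> nat \<Rightarrow> complex^'v^'v::finite" where
  "matrix_power M 0 = mat 1"
| "matrix_power M (Suc j) = M ** matrix_power M j"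

definition matrix_exp :: "complex^'v^'v \<Rightarrow> complex^'v^'v::finite" where
  "matrix_exp M = (\<Sum>j. matrix_power M j /\<^sub>R fact j)"

lemma norm_matrix_power_entry_le:
  fixes M :: "complex^'v^'v::finite"
  shows "norm (matrix_power M j $ a $ b) \<le> (\<Sum>c\<in>UNIV. \<Sum>d\<in>UNIV. norm (M $ c $ d)) ^ j"
proof (induction j arbitrary: a b)
  case 0
  show ?case by (simp add: mat_def)
next
  case (Suc j)
  let ?C = "\<Sum>c\<in>UNIV. \<Sum>d\<in>UNIV. norm (M $ c $ d)"
  have C: "?C \<ge> 0"
    by (intro sum_nonneg norm_ge_zero)
  have row: "(\<Sum>d\<in>UNIV. norm (M $ a $ d)) \<le> ?C"
    by (rule member_le_sum[of a UNIV "\<lambda>c. \<Sum>d\<in>UNIV. norm (M $ c $ d)"])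
       (simp_all add: sum_nonneg)
  have "norm (matrix_power M (Suc j) $ a $ b)
      \<le> (\<Sum>d\<in>UNIV. norm (M $ a $ d * matrix_power M j $ d $ b))"
    by (simp add: matrix_matrix_mult_def norm_sum)
  also have "\<dots> \<le> (\<Sum>d\<in>UNIV. norm (M $ a $ d) * ?C ^ j)"
    by (intro sum_mono) (simp add: norm_mult mult_left_mono Suc.IH)
  also have "\<dots> = (\<Sum>d\<in>UNIV. norm (M $ a $ d)) * ?C ^ j"
    by (simp add: sum_distrib_right)
  also have "\<dots> \<le> ?C * ?C ^ j"
    by (rule mult_right_mono[OF row zero_le_power[OF C]])
  finally show ?case by simp
qed

lemma summable_matrix_exp:
  fixes M :: "complex^'v^'v::finite"
  shows "summable (\<lambda>j. matrix_power M j /\<^sub>R fact j)"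
proof -
  define C where "C = (\<Sum>c\<in>UNIV. \<Sum>d\<in>UNIV. norm (M $ c $ d))"
  define K where "K = real CARD('v) * real CARD('v)"
  have bound: "norm (matrix_power M j /\<^sub>R fact j) \<le> K * (C ^ j /\<^sub>R fact j)" for j
  proof -
    have "norm (matrix_power M j) \<le> (\<Sum>a\<in>UNIV. norm (matrix_power M j $ a))"
      unfolding norm_vec_def by (rule L2_set_le_sum) simp
    also have "\<dots> \<le> (\<Sum>a\<in>UNIV. \<Sum>b\<in>UNIV. norm (matrix_power M j $ a $ b))"
      by (intro sum_mono) (subst norm_vec_def, rule L2_set_le_sum, simp)
    also have "\<dots> \<le> (\<Sum>a\<in>(UNIV::'v set). \<Sum>b\<in>(UNIV::'v set). C ^ j)"
      unfolding C_def by (intro sum_mono norm_matrix_power_entry_le)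
    also have "\<dots> = K * C ^ j"
      by (simp add: K_def)
    finally have "norm (matrix_power M j) / fact j \<le> K * C ^ j / fact j"
      by (intro divide_right_mono) auto
    then show ?thesis
      by (simp add: divide_inverse mult.commute mult.left_commute)
  qed
  have "summable (\<lambda>j. K * (C ^ j /\<^sub>R fact j))"
    by (intro summable_mult summable_exp_generic)
  then show ?thesis
    by (rule summable_comparison_test') (rule bound)
qed

definition quantum_walk :: "('v::finite \<Rightarrow> 'v \<Rightarrow> bool) \<Rightarrow> real \<Rightarrow> complex^'v^'v" where
  "quantum_walk X t = matrix_exp (\<chi> a b. - \<i> * complex_of_real t * adjacency_matrix X $ a $ b)"

definition instantaneous_uniform_mixing :: "('v::finite \<Rightarrow> 'v \<Rightarrow> bool) \<Rightarrow> real \<Rightarrow> bool" where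
  "instantaneous_uniform_mixing X \<tau> \<longleftrightarrow>
     (\<forall>a b. cmod (quantum_walk X \<tau> $ a $ b) = 1 / sqrt (real CARD('v)))"

text \<open>Binary words of length \<open>n\<close> are the elements of \<^typ>\<open>bool^'n\<close> with \<open>n = CARD('n)\<close>.\<close>

definition distance_graph :: "nat \<Rightarrow> bool^'n \<Rightarrow> bool^'n::finite \<Rightarrow> bool" where
  "distance_graph r u v \<longleftrightarrow> card {i. u $ i \<noteq> v $ i} = r"

lemma simple_graph_distance_graph:
  assumes "r \<ge> 1"
  shows "simple_graph (distance_graph r :: bool^'n \<Rightarrow> bool^'n::finite \<Rightarrow> bool)"
proof -
  have "card {i. v $ i \<noteq> u $ i} = card {i. u $ i \<noteq> v $ i}" for u v :: "bool^'n"
    by (rule arg_cong[where f = card]) blast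
  with assms show ?thesis
    by (simp add: simple_graph_def distance_graph_def symp_def irreflp_def)
qed

end

theory Submission
  imports Defs "HOL-Computational_Algebra.Polynomial" "HOL-Computational_Algebra.Primes"
    "HOL-Number_Theory.Cong"
begin

text \<open>
  Write \<open>f s = exp (- \<i> \<tau> K s)\<close>, where \<open>K s\<close>, the coefficient of \<open>x ^ r\<close> in
  \<open>(1 - x) ^ s (1 + x) ^ (n - s)\<close>, is the eigenvalue of the graph on the characters of weight \<open>s\<close>.
  The entries of the walk are, up to \<open>2 ^ n\<close>, the Fourier coefficients of \<open>w \<mapsto> f (weight w)\<close>.
  If \<open>f (s + 2) = - f s\<close>, then \<open>f s\<close> is a combination of \<open>\<i> ^ s\<close> and \<open>(- \<i>) ^ s\<close>, whose transforms
  are products of \<open>1 + \<i>\<close> and \<open>1 - \<i>\<close>; for \<open>8 dvd n\<close> the transform at an element of weight \<open>d\<close> is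
  \<open>2 ^ (n div 2)\<close> times \<open>f d\<close> up to sign, hence flat.

  For the antiperiodicity, \<open>K s - K (s + 2) = 4 q\<close> with \<open>q\<close> the coefficient of \<open>x ^ (r - 1)\<close> in
  \<open>(1 - x) ^ s (1 + x) ^ (n - 2 - s)\<close>, and one needs \<open>q \<equiv> 2 ^ (k - 2)\<close> modulo \<open>2 ^ (k - 1)\<close>.
  Expanding \<open>(1 - x) ^ s = ((1 + x) - 2 x) ^ s\<close> leaves binomial coefficients whose 2-adic valuations
  are complementary to those of \<open>c (D choose c)\<close> with small \<open>D\<close>.
\<close>

section \<open>Spectral form of the matrix exponential and of the walk\<close>

text \<open>Completeness writes the identity matrix as a sum of the rank-one matrices
  \<open>E w a * E w b / N\<close>, and each further factor \<open>M\<close> only multiplies the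
  \<open>w\<close>-th of them by \<open>l w\<close>. No conjugate occurs because the family used
  below is real.\<close>

lemma matrix_power_spectral:
  fixes M :: "complex^'v^'v::finite" and E :: "'w::finite \<Rightarrow> 'v \<Rightarrow> complex"
  assumes eig: "\<And>w a. (\<Sum>b\<in>UNIV. M $ a $ b * E w b) = l w * E w a"
    and complete: "\<And>a b. (\<Sum>w\<in>UNIV. E w a * E w b) = (if a = b then N else 0)"
    and "N \<noteq> 0"
  shows "matrix_power M j $ a $ b = (\<Sum>w\<in>UNIV. l w ^ j * (E w a * E w b)) / N"
proof (induction j arbitrary: a)
  case 0
  show ?case using complete \<open>N \<noteq> 0\<close> by (simp add: mat_def)
next
  case (Suc j)
  have "matrix_power M (Suc j) $ a $ b
      = (\<Sum>c\<in>UNIV. \<Sum>w\<in>UNIV. l w ^ j * E w b * (M $ a $ c * E w c)) / N"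
    by (simp add: matrix_matrix_mult_def Suc.IH sum_distrib_left sum_divide_distrib mult_ac)
  also have "(\<Sum>c\<in>UNIV. \<Sum>w\<in>UNIV. l w ^ j * E w b * (M $ a $ c * E w c))
      = (\<Sum>w\<in>UNIV. l w ^ j * E w b * (\<Sum>c\<in>UNIV. M $ a $ c * E w c))"
    by (subst sum.swap) (simp add: sum_distrib_left)
  finally show ?case
    unfolding eig by (simp add: mult_ac del: matrix_power.simps)
qed

lemma matrix_exp_spectral:
  fixes M :: "complex^'v^'v::finite" and E :: "'w::finite \<Rightarrow> 'v \<Rightarrow> complex"
  assumes eig: "\<And>w a. (\<Sum>b\<in>UNIV. M $ a $ b * E w b) = l w * E w a"
    and complete: "\<And>a b. (\<Sum>w\<in>UNIV. E w a * E w b) = (if a = b then N else 0)"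
    and N: "N \<noteq> 0"
  shows "matrix_exp M $ a $ b = (\<Sum>w\<in>UNIV. exp (l w) * (E w a * E w b)) / N"
proof -
  have "(\<lambda>j. matrix_power M j /\<^sub>R fact j) sums matrix_exp M"
    unfolding matrix_exp_def by (rule summable_sums[OF summable_matrix_exp])
  then have "(\<lambda>j. (matrix_power M j /\<^sub>R fact j) $ a $ b) sums (matrix_exp M $ a $ b)"
    by (intro bounded_linear.sums[OF bounded_linear_vec_nth])
  moreover have "(\<lambda>j. (\<Sum>w\<in>UNIV. l w ^ j /\<^sub>R fact j * (E w a * E w b)) / N)
      sums ((\<Sum>w\<in>UNIV. exp (l w) * (E w a * E w b)) / N)"
    by (intro sums_divide sums_sum sums_mult2 exp_converges)
  moreover have "(matrix_power M j /\<^sub>R fact j) $ a $ b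
      = (\<Sum>w\<in>UNIV. l w ^ j /\<^sub>R fact j * (E w a * E w b)) / N" for j
    by (simp add: matrix_power_spectral[OF eig complete N] scaleR_sum_right sum_divide_distrib)
       (simp add: scaleR_conv_of_real)
  ultimately show ?thesis by (simp add: sums_unique2)
qed

lemma quantum_walk_spectral:
  fixes X :: "'v::finite \<Rightarrow> 'v \<Rightarrow> bool" and E :: "'w::finite \<Rightarrow> 'v \<Rightarrow> complex"
  assumes eig: "\<And>w a. (\<Sum>b\<in>UNIV. adjacency_matrix X $ a $ b * E w b) = l w * E w a"
    and complete: "\<And>a b. (\<Sum>w\<in>UNIV. E w a * E w b) = (if a = b then N else 0)"
    and N: "N \<noteq> 0"
  shows "quantum_walk X t $ a $ b
    = (\<Sum>w\<in>UNIV. exp (- \<i> * complex_of_real t * l w) * (E w a * E w b)) / N"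
  unfolding quantum_walk_def
proof (rule matrix_exp_spectral[OF _ complete N])
  fix w a
  show "(\<Sum>b\<in>UNIV. (\<chi> a b. - \<i> * complex_of_real t * adjacency_matrix X $ a $ b) $ a $ b * E w b)
      = - \<i> * complex_of_real t * l w * E w a"
    using eig[of a w] by (simp add: sum_distrib_left[symmetric] sum_negf mult.assoc)
qed

section \<open>Characters of the cube and the eigenvalues of the distance graphs\<close>

lemma sum_prod_vec:
  fixes g :: "'n::finite \<Rightarrow> 'b::finite \<Rightarrow> 'a::comm_semiring_1"
  shows "(\<Sum>w\<in>(UNIV::('b^'n) set). \<Prod>i\<in>UNIV. g i (w $ i)) = (\<Prod>i\<in>UNIV. \<Sum>b\<in>UNIV. g i b)"
proof -
  have "(\<Prod>i\<in>UNIV. \<Sum>b\<in>UNIV. g i b) = (\<Sum>f\<in>UNIV. \<Prod>i\<in>UNIV. g i (f i))"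
    by (subst prod_sum_PiE) (simp_all add: PiE_UNIV_domain)
  also have "\<dots> = (\<Sum>w\<in>(UNIV::('b^'n) set). \<Prod>i\<in>UNIV. g i (w $ i))"
    by (rule sum.reindex_bij_witness[where i = vec_nth and j = vec_lambda]) auto
  finally show ?thesis ..
qed

lemma prod_if_UNIV:
  fixes x y :: "'a::comm_monoid_mult"
  shows "(\<Prod>i\<in>(UNIV::'n::finite set). if P i then x else y)
    = x ^ card {i. P i} * y ^ (CARD('n) - card {i. P i})"
proof -
  have "card (- {i. P i}) = CARD('n) - card {i. P i}"
    by (simp add: Compl_eq_Diff_UNIV card_Diff_subset)
  then show ?thesis
    by (simp add: prod.If_cases Collect_neg_eq)
qed

text \<open>The sign (-1)^(w.v), kept in the integers so that it can be mapped into any commutative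
  ring and also serve as a polynomial coefficient.\<close>

definition character :: "bool^'n::finite \<Rightarrow> bool^'n \<Rightarrow> int" where
  "character w v = (\<Prod>i\<in>UNIV. if w $ i \<and> v $ i then - 1 else 1)"

definition weight :: "bool^'n::finite \<Rightarrow> nat" where
  "weight w = card {i. w $ i}"

text \<open>The binary Krawtchouk polynomial of degree \<open>r\<close> at \<open>s\<close>, given
  by its generating function; this reading requires \<open>s \<le> n\<close>, since
  \<open>n - s\<close> is truncated.\<close>

definition krawtchouk :: "nat \<Rightarrow> nat \<Rightarrow> nat \<Rightarrow> int" where
  "krawtchouk n r s = coeff ([:1, - 1:] ^ s * [:1, 1:] ^ (n - s)) r"

text \<open>The summand is a product over coordinates, so the sum factors: a coordinate where
  \<open>u\<close> and \<open>v\<close> agree gives 1 + z, any other gives 1 - z. Taking z = 1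
  yields orthogonality, and z = i, -i the transforms of antiperiodic functions.\<close>

lemma sum_character_mult_power:
  fixes u v :: "bool^'n::finite" and z :: "'a::comm_ring_1"
  shows "(\<Sum>w\<in>UNIV. of_int (character w u * character w v) * z ^ weight w)
    = (1 - z) ^ card {i. u $ i \<noteq> v $ i} * (1 + z) ^ (CARD('n) - card {i. u $ i \<noteq> v $ i})"
proof -
  have "of_int (character w u * character w v) * z ^ weight w
      = (\<Prod>i\<in>UNIV. (if w $ i \<and> u $ i then - 1 else 1) * (if w $ i \<and> v $ i then - 1 else 1)
          * (if w $ i then z else 1))" for w
    by (simp add: character_def weight_def prod.distrib prod_if_UNIV[of _ z 1] of_int_prod
        if_distrib[of of_int] cong: if_cong)
  then have "(\<Sum>w\<in>UNIV. of_int (character w u * character w v) * z ^ weight w)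
      = (\<Prod>i\<in>UNIV. \<Sum>b\<in>UNIV. (if b \<and> u $ i then - 1 else 1) * (if b \<and> v $ i then - 1 else 1)
          * (if b then z else 1))"
    using sum_prod_vec[of "\<lambda>i b. (if b \<and> u $ i then - 1 else 1) * (if b \<and> v $ i then - 1 else 1)
          * (if b then z else 1)"] by simp
  also have "\<dots> = (\<Prod>i\<in>UNIV. if u $ i \<noteq> v $ i then 1 - z else 1 + z)"
    by (rule prod.cong) (auto simp: UNIV_bool)
  finally show ?thesis by (simp add: prod_if_UNIV)
qed

lemma character_orthogonality:
  fixes u v :: "bool^'n::finite"
  shows "(\<Sum>w\<in>UNIV. character w u * character w v) = (if u = v then 2 ^ CARD('n) else 0)"
proof -
  have "card {i. u $ i \<noteq> v $ i} = 0 \<longleftrightarrow> u = v"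
    by (auto simp: vec_eq_iff)
  then show ?thesis
    using sum_character_mult_power[of u v "1::int"] by (auto simp: power_0_left)
qed

text \<open>Every coordinate where \<open>v\<close> differs from \<open>u\<close> is marked by a
  factor x. The sum over all \<open>v\<close> then factors over coordinates, and extracting the
  coefficient of x^r restricts it to the neighbours of \<open>u\<close>.\<close>

lemma distance_graph_eigenvector:
  fixes u w :: "bool^'n::finite"
  shows "(\<Sum>v\<in>UNIV. (if distance_graph r u v then 1 else 0) * character w v)
    = krawtchouk CARD('n) r (weight w) * character w u"
proof -
  define g :: "'n \<Rightarrow> bool \<Rightarrow> int poly" where
    "g i b = (if u $ i \<noteq> b then [:0, 1:] else 1) * [:if w $ i \<and> b then - 1 else 1:]" for i b
  have const: "(\<Prod>i\<in>UNIV. [:h i:]) = [:\<Prod>i\<in>UNIV. h i:]" for h :: "'n \<Rightarrow> int"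
    by (induction rule: infinite_finite_induct) (auto simp: one_pCons)
  have "(\<Prod>i\<in>UNIV. g i (v $ i)) = monom (character w v) (card {i. u $ i \<noteq> v $ i})" for v
    unfolding g_def prod.distrib const prod_if_UNIV[of _ "[:0, 1:]"] character_def
    by (simp add: monom_altdef)
  then have "(\<Sum>v\<in>UNIV. (if distance_graph r u v then 1 else 0) * character w v)
      = coeff (\<Sum>v\<in>UNIV. \<Prod>i\<in>UNIV. g i (v $ i)) r"
    by (auto simp: coeff_sum distance_graph_def intro!: sum.cong)
  also have "(\<Sum>v\<in>UNIV. \<Prod>i\<in>UNIV. g i (v $ i)) = (\<Prod>i\<in>UNIV. \<Sum>b\<in>UNIV. g i b)"
    by (rule sum_prod_vec)
  also have "\<dots> = (\<Prod>i\<in>UNIV. [:if w $ i \<and> u $ i then - 1 else 1:]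
      * (if w $ i then [:1, - 1:] else [:1, 1:]))"
    by (rule prod.cong) (auto simp: UNIV_bool g_def one_pCons)
  also have "\<dots> = smult (character w u) ([:1, - 1:] ^ weight w * [:1, 1:] ^ (CARD('n) - weight w))"
    unfolding prod.distrib const prod_if_UNIV[of _ "[:1, - 1:]"] character_def weight_def by simp
  finally show ?thesis by (simp add: krawtchouk_def)
qed

lemma quantum_walk_distance_graph:
  fixes u v :: "bool^'n::finite"
  shows "quantum_walk (distance_graph r) t $ u $ v
    = (\<Sum>w\<in>UNIV. exp (- \<i> * complex_of_real t * of_int (krawtchouk CARD('n) r (weight w)))
        * of_int (character w u * character w v)) / 2 ^ CARD('n)"
proof -
  have eig: "(\<Sum>b\<in>UNIV. adjacency_matrix (distance_graph r) $ a $ b * complex_of_int (character w b))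
      = of_int (krawtchouk CARD('n) r (weight w)) * of_int (character w a)" for w a :: "bool^'n"
  proof -
    have "(\<Sum>b\<in>UNIV. adjacency_matrix (distance_graph r) $ a $ b * complex_of_int (character w b))
      = of_int (\<Sum>b\<in>UNIV. (if distance_graph r a b then 1 else 0) * character w b)"
      by (auto simp: adjacency_matrix_def intro!: sum.cong)
    then show ?thesis by (simp only: distance_graph_eigenvector of_int_mult)
  qed
  have complete: "(\<Sum>w\<in>UNIV. complex_of_int (character w a) * of_int (character w b))
      = (if a = b then 2 ^ CARD('n) else 0)" for a b :: "bool^'n"
    using arg_cong[OF character_orthogonality[of a b], of complex_of_int]
    by (simp split: if_splits)
  show ?thesis
    using quantum_walk_spectral[OF eig complete, of t u v] by simp
qed

section \<open>Flat Fourier transforms of antiperiodic functions\<close>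

lemma one_plus_i_power:
  assumes "8 dvd n"
  shows "(1 + \<i>) ^ n = 2 ^ (n div 2)" "(1 - \<i>) ^ n = 2 ^ (n div 2)"
proof -
  obtain m where n: "n = 8 * m" using assms by blast
  have "(1 + \<i>) ^ 8 = 2 ^ 4" "(1 - \<i>) ^ 8 = 2 ^ 4"
    by (simp_all add: numeral_eq_Suc field_simps)
  then show "(1 + \<i>) ^ n = 2 ^ (n div 2)" "(1 - \<i>) ^ n = 2 ^ (n div 2)"
    by (simp_all add: n power_mult)
qed

lemma cmod_sum_character_antiperiodic:
  fixes f :: "nat \<Rightarrow> complex" and u v :: "bool^'n::finite"
  assumes n: "8 dvd CARD('n)"
    and step: "\<And>s. s + 2 \<le> CARD('n) \<Longrightarrow> f (s + 2) = - f s"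
    and unit: "\<And>s. cmod (f s) = 1"
  shows "cmod (\<Sum>w\<in>UNIV. f (weight w) * of_int (character w u * character w v))
    = 2 ^ (CARD('n) div 2)"
proof -
  \<comment> \<open>The recurrence leaves \<open>f 0\<close> and \<open>f 1\<close> free; these
    coefficients solve \<alpha> + \<beta> = f 0 and i(\<alpha> - \<beta>) = f 1.\<close>
  define \<alpha> \<beta> where "\<alpha> = (f 0 - \<i> * f 1) / 2" and "\<beta> = (f 0 + \<i> * f 1) / 2"
  define d where "d = card {i. u $ i \<noteq> v $ i}"
  have d: "d \<le> CARD('n)" unfolding d_def by (rule card_mono) auto
  have f: "f s = \<alpha> * \<i> ^ s + \<beta> * (- \<i>) ^ s" if "s \<le> CARD('n)" for s
    using that
  proof (induction s rule: nat_less_induct)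
    case (1 s)
    consider "s = 0" | "s = 1" | t where "s = t + 2"
      by (metis One_nat_def add_2_eq_Suc' not0_implies_Suc)
    then show ?case
    proof cases
      case 3
      then have "f t = \<alpha> * \<i> ^ t + \<beta> * (- \<i>) ^ t" using 1 by simp
      then show ?thesis using step[of t] 1 3 by simp
    qed (simp_all add: \<alpha>_def \<beta>_def field_simps)
  qed
  have wt: "weight w \<le> CARD('n)" for w :: "bool^'n"
    unfolding weight_def by (rule card_mono) auto
  have "(\<Sum>w\<in>UNIV. f (weight w) * of_int (character w u * character w v))
    = \<alpha> * (\<Sum>w\<in>UNIV. of_int (character w u * character w v) * \<i> ^ weight w)
    + \<beta> * (\<Sum>w\<in>UNIV. of_int (character w u * character w v) * (- \<i>) ^ weight w)"
    by (simp add: f wt sum_distrib_left sum.distrib algebra_simps)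
  also have "\<dots> = \<alpha> * ((1 - \<i>) ^ d * (1 + \<i>) ^ (CARD('n) - d))
    + \<beta> * ((1 + \<i>) ^ d * (1 - \<i>) ^ (CARD('n) - d))"
    by (simp only: sum_character_mult_power d_def diff_minus_eq_add minus_minus flip: diff_conv_add_uminus)
  \<comment> \<open>Since 1 - i = -i(1 + i), both factors become powers of 1 + i with total exponent
    \<open>CARD('n)\<close>; the other term is conjugate.\<close>
  also have "(1 - \<i>) ^ d * (1 + \<i>) ^ (CARD('n) - d) = (- \<i>) ^ d * 2 ^ (CARD('n) div 2)"
  proof -
    have "(1 - \<i>) ^ d = (- \<i>) ^ d * (1 + \<i>) ^ d"
      by (simp flip: power_mult_distrib add: algebra_simps)
    then show ?thesis using d one_plus_i_power(1)[OF n] by (simp add: mult.assoc flip: power_add)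
  qed
  also have "(1 + \<i>) ^ d * (1 - \<i>) ^ (CARD('n) - d) = \<i> ^ d * 2 ^ (CARD('n) div 2)"
  proof -
    have "(1 + \<i>) ^ d = \<i> ^ d * (1 - \<i>) ^ d"
      by (simp flip: power_mult_distrib add: algebra_simps)
    then show ?thesis using d one_plus_i_power(2)[OF n] by (simp add: mult.assoc flip: power_add)
  qed
  \<comment> \<open>The roles of i and -i are now exchanged; as (-i)^d = (-1)^d i^d, this restores
    \<open>f d\<close> up to sign.\<close>
  also have "\<alpha> * ((- \<i>) ^ d * 2 ^ (CARD('n) div 2)) + \<beta> * (\<i> ^ d * 2 ^ (CARD('n) div 2))
    = (- 1) ^ d * f d * 2 ^ (CARD('n) div 2)"
    by (simp add: f d algebra_simps flip: power_mult_distrib)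
  finally show ?thesis by (simp add: norm_mult norm_power unit)
qed

section \<open>2-adic valuations of binomial coefficients\<close>

text \<open>
  The numbers \<open>r (m choose r)\<close> are the reciprocals of the entries of the Leibniz harmonic triangle:
  the entry at \<open>(m, r + 1)\<close> is the difference of those at \<open>(m - 1, r)\<close> and \<open>(m, r)\<close>.
\<close>

lemma leibniz_triangle_dvd:
  fixes L :: nat
  assumes "\<And>x. 1 \<le> x \<Longrightarrow> x \<le> m \<Longrightarrow> x dvd L"
    and "Suc r \<le> m"
  shows "Suc r * (m choose Suc r) dvd L"
  using assms
proof (induction r arbitrary: m)
  case 0
  then show ?case by simp
next
  case (Suc r)
  then obtain p where m: "m = Suc p" by (cases m) auto
  define x y z where "x = int (Suc r * (p choose Suc r))" and "y = int (Suc r * (m choose Suc r))"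
    and "z = int (Suc (Suc r) * (m choose Suc (Suc r)))"
  have "Suc r * (p choose Suc r) dvd L" "Suc r * (m choose Suc r) dvd L"
    using Suc.IH[of p] Suc.IH[of m] Suc.prems m by (simp_all del: binomial_Suc_Suc mult_Suc)
  then have "x dvd int L" "y dvd int L"
    unfolding x_def y_def by (simp_all only: int_dvd_int_iff)
  then obtain a b where a: "int L = x * a" and b: "int L = y * b" by (elim dvdE)
  have pos: "x > 0" "y > 0" using Suc.prems m by (simp_all add: x_def y_def del: mult_Suc binomial_Suc_Suc)
  have y: "y = int (m * (p choose r))"
    unfolding y_def m by (simp only: Suc_times_binomial_eq mult.commute)
  have z: "z = int (m * (p choose Suc r))"
    unfolding z_def m by (simp only: Suc_times_binomial_eq mult.commute)
  have "y - x = int (Suc r * (p choose r))"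
    by (simp add: y_def x_def m algebra_simps)
  \<comment> \<open>This is 1/z = 1/x - 1/y with denominators cleared, so L/z = L/x - L/y = a - b is
    an integer.\<close>
  then have rel: "z * (y - x) = x * y"
    unfolding z by (simp add: y x_def del: mult_Suc mult_Suc_right)
  have "x * y * int L = x * y * (z * (a - b))"
  proof -
    have "x * y * (z * (a - b)) = z * ((x * a) * y - (y * b) * x)" by (simp add: algebra_simps)
    also have "\<dots> = z * (y - x) * int L" unfolding a[symmetric] b[symmetric] by (simp add: algebra_simps)
    finally show ?thesis by (simp only: rel)
  qed
  moreover have "x * y \<noteq> 0" using pos by simp
  ultimately have "int L = z * (a - b)" by (metis mult_left_cancel)
  then have "z dvd int L" by (metis dvd_triv_left)
  then show ?case unfolding z_def by (simp only: int_dvd_int_iff)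
qed

text \<open>Because m < 2^(e+1), no number in 1..m has valuation above e. Hence 2^e times the
  product of the odd numbers up to m is a common multiple of 1..m of valuation e, and the Leibniz
  triangle bound applies to it.\<close>

lemma multiplicity_times_choose_le:
  assumes "m < 2 ^ Suc e" "1 \<le> r" "r \<le> m"
  shows "multiplicity 2 (r * (m choose r)) \<le> e"
proof -
  define P where "P = \<Prod>{x. x \<le> m \<and> odd x}"
  have P: "odd P" unfolding P_def
    by (subst even_prod_iff) auto
  have "x dvd 2 ^ e * P" if x: "1 \<le> x" "x \<le> m" for x
  proof -
    obtain y where y: "x = 2 ^ multiplicity 2 x * y" "\<not> 2 dvd y"
      using multiplicity_decompose'[of x 2] x by auto
    have "2 ^ multiplicity 2 x \<le> x"
      using x by (intro dvd_imp_le multiplicity_dvd) auto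
    then have "(2::nat) ^ multiplicity 2 x < 2 ^ Suc e" using x assms by linarith
    then have "multiplicity 2 x \<le> e" by (subst (asm) power_strict_increasing_iff) auto
    moreover have "y dvd P"
    proof -
      have "y \<le> x" by (metis y(1) dvd_imp_le dvd_triv_right x(1) less_le_trans zero_less_one)
      then show ?thesis unfolding P_def using y(2) x by (intro dvd_prodI) auto
    qed
    ultimately show ?thesis by (subst y(1)) (intro mult_dvd_mono le_imp_power_dvd)
  qed
  then have "r * (m choose r) dvd 2 ^ e * P"
    using leibniz_triangle_dvd[of m "2 ^ e * P" "r - 1"] assms by simp
  then have "multiplicity 2 (r * (m choose r)) \<le> multiplicity 2 (2 ^ e * P)"
    using P by (intro dvd_imp_multiplicity_le) (auto intro!: Nat.gr0I)
  also have "\<dots> = e"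
    using P by (intro multiplicity_eqI) auto
  finally show ?thesis .
qed

text \<open>For d up to e, 2^d divides both of x and 2^e - x or neither, and the valuation of x is
  less than e. This reflection is the only way valuations are compared below.\<close>

lemma multiplicity_2_diff:
  assumes "0 < x" "x < (2::nat) ^ e"
  shows "multiplicity 2 (2 ^ e - x) = multiplicity 2 x"
proof -
  have "2 ^ multiplicity 2 x \<le> x"
    using assms by (intro dvd_imp_le multiplicity_dvd) auto
  then have "(2::nat) ^ multiplicity 2 x < 2 ^ e" using assms by linarith
  then have v: "multiplicity 2 x < e" by (subst (asm) power_strict_increasing_iff) auto
  have iff: "2 ^ d dvd 2 ^ e - x \<longleftrightarrow> 2 ^ d dvd x" if "d \<le> e" for d
  proof -
    have "2 ^ d dvd (2 ^ e - x) + x \<longleftrightarrow> True" using that assms by (simp add: le_imp_power_dvd)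
    then show ?thesis by (metis dvd_add_right_iff dvd_add_left_iff)
  qed
  show ?thesis
  proof (rule multiplicity_eqI)
    show "2 ^ multiplicity 2 x dvd 2 ^ e - x" using iff v by (simp add: multiplicity_dvd)
    have "\<not> 2 ^ Suc (multiplicity 2 x) dvd x" using assms by (subst power_dvd_iff_le_multiplicity) auto
    then show "\<not> 2 ^ Suc (multiplicity 2 x) dvd 2 ^ e - x" using iff[of "Suc (multiplicity 2 x)"] v by simp
  qed
qed

text \<open>A case of Lucas's theorem. Passing from m to m + 1 multiplies the binomial by (2^e + m +
  1)/(m + 1); reflecting first in 2^(e+1) and then in 2^e shows that this ratio has valuation
  0.\<close>

lemma odd_choose_pow2_add:
  assumes "m < (2::nat) ^ e"
  shows "odd ((2 ^ e + m) choose m)"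
  using assms
proof (induction m)
  case 0
  then show ?case by simp
next
  case (Suc m)
  have "2 ^ e + Suc m = 2 ^ Suc e - (2 ^ e - Suc m)" using Suc by simp
  then have "multiplicity 2 (2 ^ e + Suc m) = multiplicity 2 (2 ^ e - Suc m)"
    using Suc.prems multiplicity_2_diff[of "2 ^ e - Suc m" "Suc e"] by simp
  also have "\<dots> = multiplicity 2 (Suc m)"
    using Suc.prems by (intro multiplicity_2_diff) auto
  finally have v: "multiplicity 2 (Suc (2 ^ e + m)) = multiplicity 2 (Suc m)" by simp
  have "Suc m * (Suc (2 ^ e + m) choose Suc m) = Suc (2 ^ e + m) * ((2 ^ e + m) choose m)"
    using Suc_times_binomial_eq[of "2 ^ e + m" m] by (simp add: mult.commute)
  then have "multiplicity 2 (Suc m * (Suc (2 ^ e + m) choose Suc m))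
      = multiplicity 2 (Suc (2 ^ e + m) * ((2 ^ e + m) choose m))" by (simp only:)
  then have "multiplicity 2 (Suc (2 ^ e + m) choose Suc m) = multiplicity 2 ((2 ^ e + m) choose m)"
    using v by (subst (asm) (1 2) prime_elem_multiplicity_mult_distrib) auto
  also have "\<dots> = 0" using Suc by (simp add: not_dvd_imp_multiplicity_0)
  finally show ?case by (simp add: multiplicity_eq_zero_iff del: binomial_Suc_Suc)
qed

lemma choose_add_symmetric: "(x + y) choose y = (x + y) choose x" for x y :: nat
  using binomial_symmetric[of x "x + y"] by simp

text \<open>Trades a large binomial for one with a small lower index. Put D = 2^e - m + c. Raising c
  by one multiplies the first binomial by (2^e - c - 1)/(m + 2^e - c - 1) and the second product by
  (D + 1)/(c + 1). By reflection these ratios have opposite valuations, so the sum is constant in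
  c.\<close>

lemma multiplicity_choose_pow2:
  assumes "m < (2::nat) ^ e" "Suc c \<le> 2 ^ e"
  shows "multiplicity 2 ((m + (2 ^ e - Suc c)) choose m)
    + multiplicity 2 (Suc c * ((2 ^ e - m + c) choose Suc c)) = e"
  using assms(2)
proof (induction c)
  case 0
  define C where "C = (m + (2 ^ e - 1)) choose m"
  have "C \<noteq> 0" unfolding C_def by (metis binomial_eq_0_iff le_add1 not_less)
  \<comment> \<open>Absorption identity for c = 0: the left side is 2^e times an odd binomial, so
    its valuation is exactly e.\<close>
  have "Suc (2 ^ e - 1) * ((Suc (2 ^ e - 1) + m) choose Suc (2 ^ e - 1)) = (m + 2 ^ e) * ((m + (2 ^ e - 1)) choose (2 ^ e - 1))"
    using Suc_times_binomial_eq[of "m + (2 ^ e - 1)" "2 ^ e - 1"] by (simp add: mult.commute add.commute)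
  moreover have "(m + (2 ^ e - 1)) choose (2 ^ e - 1) = C"
    unfolding C_def by (rule choose_add_symmetric)
  moreover have "(Suc (2 ^ e - 1) + m) choose Suc (2 ^ e - 1) = (2 ^ e + m) choose m"
    using choose_add_symmetric[of m "2 ^ e"] by (simp add: add.commute)
  ultimately have "2 ^ e * ((2 ^ e + m) choose m) = (m + 2 ^ e) * C" by simp
  then have "multiplicity 2 (2 ^ e * ((2 ^ e + m) choose m)) = multiplicity 2 ((m + 2 ^ e) * C)"
    by (simp only:)
  moreover have "multiplicity 2 (2 ^ e * ((2 ^ e + m) choose m)) = e"
    using odd_choose_pow2_add[OF assms(1)] by (intro multiplicity_eqI) auto
  moreover have "multiplicity 2 ((m + 2 ^ e) * C) = multiplicity 2 (m + 2 ^ e) + multiplicity 2 C"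
    using \<open>C \<noteq> 0\<close> by (intro prime_elem_multiplicity_mult_distrib) auto
  moreover have "multiplicity 2 (m + 2 ^ e) = multiplicity 2 (2 ^ e - m)"
    using multiplicity_2_diff[of "2 ^ e - m" "Suc e"] assms(1) by (simp add: add.commute mult_2 less_imp_diff_less)
  ultimately show ?case by (simp add: C_def)
next
  case (Suc c)
  define l D where "l = 2 ^ e - Suc (Suc c)" and "D = 2 ^ e - m + c"
  define C C' where "C = (m + Suc l) choose m" and "C' = (m + l) choose m"
  have l: "2 ^ e - Suc c = Suc l" using Suc.prems by (simp add: l_def)
  have IH: "multiplicity 2 C + multiplicity 2 (Suc c * (D choose Suc c)) = e"
    using Suc l by (simp add: C_def D_def)
  have D: "Suc c \<le> D" using assms(1) by (simp add: D_def)
  have "Suc l * C = Suc (m + l) * C'"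
  proof -
    have "(m + Suc l) choose m = Suc (m + l) choose Suc l" "(m + l) choose m = (m + l) choose l"
      using choose_add_symmetric[of m "Suc l"] choose_add_symmetric[of m l] by simp_all
    then show ?thesis using Suc_times_binomial_eq[of "m + l" l] unfolding C_def C'_def by (simp add: mult.commute)
  qed
  then have "multiplicity 2 (Suc l * C) = multiplicity 2 (Suc (m + l) * C')" by (simp only:)
  then have 1: "multiplicity 2 (Suc l) + multiplicity 2 C = multiplicity 2 (Suc (m + l)) + multiplicity 2 C'"
    by (subst (asm) (1 2) prime_elem_multiplicity_mult_distrib) (auto simp: C_def C'_def)
  have 2: "multiplicity 2 (Suc l) = multiplicity 2 (Suc c)"
    using Suc.prems multiplicity_2_diff[of "Suc c" e] l by simp
  have "Suc (m + l) = 2 ^ Suc e - Suc D"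
    using Suc.prems assms(1) by (simp add: l_def D_def)
  moreover have "Suc D < 2 ^ Suc e" using Suc.prems by (simp add: D_def)
  ultimately have 3: "multiplicity 2 (Suc (m + l)) = multiplicity 2 (Suc D)"
    using multiplicity_2_diff[of "Suc D" "Suc e"] by simp
  have "Suc (Suc c) * (Suc D choose Suc (Suc c)) = Suc D * (D choose Suc c)"
    by (simp only: Suc_times_binomial_eq mult.commute)
  then have 4: "multiplicity 2 (Suc (Suc c) * (Suc D choose Suc (Suc c)))
      = multiplicity 2 (Suc D) + multiplicity 2 (D choose Suc c)"
    using D by (simp only:, intro prime_elem_multiplicity_mult_distrib) auto
  have 5: "multiplicity 2 (Suc c * (D choose Suc c)) = multiplicity 2 (Suc c) + multiplicity 2 (D choose Suc c)"
    using D by (intro prime_elem_multiplicity_mult_distrib) auto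
  have "2 ^ e - m + Suc c = Suc D" by (simp add: D_def)
  then show ?case using IH 1 2 3 4 5 unfolding C'_def l_def by simp
qed

section \<open>Expansion, differences and residues of Krawtchouk values\<close>

lemma coeff_one_plus_x_power: "coeff ([:1, 1:] ^ n) j = (of_nat (n choose j) :: 'a::comm_ring_1)"
proof (induction n arbitrary: j)
  case 0
  then show ?case by (simp add: coeff_pCons one_pCons split: nat.splits)
next
  case (Suc n)
  then show ?case by (cases j) (simp_all add: algebra_simps)
qed

text \<open>After 1 - x = (1 + x) - 2x is expanded, the leftover powers of 1 + x combine to exponent
  n - i. The guard \<open>i \<le> j\<close> matters: truncated subtraction would otherwise give a
  binomial equal to 1 instead of 0.\<close>

lemma krawtchouk_expand:
  assumes "s \<le> n"
  shows "krawtchouk n j s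
    = (\<Sum>i\<le>s. (- 2) ^ i * int (s choose i) * (if i \<le> j then int ((n - i) choose (j - i)) else 0))"
proof -
  have "[:1, - 1:] = [:0, - 2:] + [:1, 1 :: int:]" by simp
  then have "[:1, - 1:] ^ s * [:1, 1 :: int:] ^ (n - s)
      = (\<Sum>i\<le>s. of_nat (s choose i) * [:0, - 2:] ^ i * [:1, 1:] ^ (s - i)) * [:1, 1:] ^ (n - s)"
    by (simp only: binomial_ring)
  also have "\<dots> = (\<Sum>i\<le>s. monom ((- 2) ^ i * int (s choose i)) i * [:1, 1:] ^ (n - i))"
    unfolding sum_distrib_right
  proof (rule sum.cong)
    fix i assume i: "i \<in> {..s}"
    then have "[:1, 1 :: int:] ^ (n - i) = [:1, 1:] ^ (s - i) * [:1, 1:] ^ (n - s)"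
      using assms by (simp flip: power_add)
    moreover have "[:0, - 2 :: int:] = monom (- 2) 1" by (simp add: monom_altdef)
    then have "of_nat (s choose i) * [:0, - 2 :: int:] ^ i = monom ((- 2) ^ i * int (s choose i)) i"
      by (simp add: monom_power of_nat_poly smult_monom mult.commute)
    ultimately show "of_nat (s choose i) * [:0, - 2:] ^ i * [:1, 1:] ^ (s - i) * [:1, 1:] ^ (n - s)
      = monom ((- 2) ^ i * int (s choose i)) i * [:1, 1:] ^ (n - i)" by (simp add: mult.assoc)
  qed simp
  finally show ?thesis
    by (auto simp: krawtchouk_def coeff_sum coeff_monom_mult coeff_one_plus_x_power intro!: sum.cong)
qed

text \<open>Follows from (1 + x)^2 - (1 - x)^2 = 4x; the factor x lowers the index by one.\<close>

lemma krawtchouk_diff: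
  assumes "s + 2 \<le> n" "r \<ge> 1"
  shows "krawtchouk n r s - krawtchouk n r (s + 2) = 4 * krawtchouk (n - 2) (r - 1) s"
proof -
  obtain m where n: "n = s + 2 + m" using assms le_Suc_ex by blast
  obtain j where r: "r = Suc j" using assms by (cases r) auto
  have "[:1, 1:] ^ 2 - [:1, - 1:] ^ 2 = monom (4::int) 1"
    by (simp add: power2_eq_square monom_altdef)
  then have sq: "[:1, 1:] ^ 2 = [:1, - 1:] ^ 2 + monom (4::int) 1" by (simp add: algebra_simps)
  have "[:1, - 1:] ^ s * [:1, 1:] ^ (n - s) - [:1, - 1:] ^ (s + 2) * [:1, 1:] ^ (n - (s + 2))
    = monom (4::int) 1 * ([:1, - 1:] ^ s * [:1, 1:] ^ (n - 2 - s))"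
  proof -
    have "n - s = 2 + m" "n - (s + 2) = m" "n - 2 - s = m" using n by auto
    then show ?thesis by (simp only: power_add sq algebra_simps)
  qed
  then show ?thesis unfolding krawtchouk_def coeff_diff[symmetric]
    by (simp only:) (simp add: coeff_monom_mult r)
qed

lemma krawtchouk_middle_cong:
  assumes "k \<ge> 2" and a: "a \<in> {1, 2, 3, 4}" and s: "s \<le> 2 ^ (k + 2) - 10"
  shows "[krawtchouk (2 ^ (k + 2) - 10) (2 ^ (k + 1) - 2 * a) s = 2 ^ (k - 2)] (mod 2 ^ (k - 1))"
proof -
  \<comment> \<open>\<open>c\<close> is chosen so that n - j = 2^(k+1) - (c + 1); thus c + 1 is 8,
    6, 4 or 2.\<close>
  define n j c where "n = 2 ^ (k + 2) - (10::nat)" and "j = 2 ^ (k + 1) - 2 * a" and "c = 9 - 2 * a"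
  have k: "(8::nat) \<le> 2 ^ (k + 1)"
    using power_increasing[of 3 "k + 1" "2::nat"] assms by simp
  have n: "n = j + (2 ^ (k + 1) - Suc c)"
    using k a by (auto simp: n_def j_def c_def)
  \<comment> \<open>Complementarity with exponent k + 1 and m = j - i. The upper index 2^(k+1) - (j
    - i) + c collapses to i + 9, whatever \<open>a\<close> is.\<close>
  have val: "multiplicity 2 ((n - i) choose (j - i)) + multiplicity 2 (Suc c * ((i + 9) choose Suc c)) = k + 1"
    if "i \<le> j" for i
  proof -
    have "j - i < 2 ^ (k + 1)" using k a by (auto simp: j_def)
    moreover have "Suc c \<le> 2 ^ (k + 1)" using k a by (auto simp: c_def)
    moreover have "n - i = j - i + (2 ^ (k + 1) - Suc c)" using n that by simp
    moreover have "i + 9 = 2 ^ (k + 1) - (j - i) + c" using that k a by (auto simp: j_def c_def)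
    ultimately show ?thesis using multiplicity_choose_pow2[of "j - i" "k + 1" c] by (simp only:)
  qed
  have "multiplicity 2 (Suc c * (9 choose Suc c)) = 3"
  proof -
    \<comment> \<open>The four values are 8 * 9, 6 * 84, 4 * 126 and 2 * 36; both 72 and 504 are 8
      times an odd number.\<close>
    have "Suc c * (9 choose Suc c) \<in> {72, 504}"
      using a by (auto simp: c_def numeral_eq_Suc)
    moreover have "multiplicity 2 (72::nat) = 3" "multiplicity 2 (504::nat) = 3"
      by (rule multiplicity_eqI; simp)+
    ultimately show ?thesis by auto
  qed
  with val[of 0] assms have v0: "multiplicity 2 (n choose j) = k - 2" by simp
  have "[int (n choose j) = 2 ^ (k - 2)] (mod 2 ^ (k - 1))"
  proof -
    have "n choose j \<noteq> 0" using n by simp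
    then obtain y where "n choose j = 2 ^ (k - 2) * y" "odd y"
      using multiplicity_decompose'[of "n choose j" 2] v0 by auto
    then obtain t where t: "n choose j = 2 ^ (k - 2) * (2 * t + 1)" by (elim oddE) auto
    have "k - 1 = Suc (k - 2)" using assms by simp
    then have "int (n choose j) - 2 ^ (k - 2) = 2 ^ (k - 1) * int t"
      by (simp add: t algebra_simps)
    then show ?thesis by (simp add: cong_iff_dvd_diff)
  qed
  \<comment> \<open>The power of 2 supplies i, and the binomial at least k + 1 - (i + 2), which
    makes k - 1 in total.\<close>
  moreover have "[(- 2) ^ i * int (s choose i) * (if i \<le> j then int ((n - i) choose (j - i)) else 0) = 0]
    (mod 2 ^ (k - 1))" if "i \<noteq> 0" for i
  proof (cases "i \<le> j")
    case True
    \<comment> \<open>Fails at i = 0, where 9 > 8: this is why exactly the term i = 0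
      survives.\<close>
    have "i + 9 < 2 ^ Suc (i + 2)"
    proof (cases i)
      case (Suc h)
      have "h < 2 ^ h" by (rule less_exp)
      then have "h + 10 < 16 * 2 ^ h" by linarith
      then show ?thesis using Suc by (simp add: power_add)
    qed (use that in simp)
    then have "multiplicity 2 (Suc c * ((i + 9) choose Suc c)) \<le> i + 2"
      using a by (intro multiplicity_times_choose_le) (auto simp: c_def add.commute)
    then have "k - 1 - i \<le> multiplicity 2 ((n - i) choose (j - i))"
      using val[OF True] by linarith
    then have "2 ^ (k - 1 - i) dvd ((n - i) choose (j - i))" by (rule multiplicity_dvd')
    then have "2 ^ (k - 1 - i) dvd int ((n - i) choose (j - i))"
      by (metis int_dvd_int_iff of_nat_numeral of_nat_power)
    then have "2 ^ i * 2 ^ (k - 1 - i) dvd (- 2) ^ i * int ((n - i) choose (j - i))"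
      by (intro mult_dvd_mono) (auto simp: power_minus')
    \<comment> \<open>If i exceeds k - 1 the truncated exponent is 0, and 2^i alone
      suffices.\<close>
    moreover have "(2::int) ^ (k - 1) dvd 2 ^ i * 2 ^ (k - 1 - i)"
      by (simp add: le_imp_power_dvd flip: power_add)
    ultimately have "2 ^ (k - 1) dvd (- 2) ^ i * int ((n - i) choose (j - i)) * int (s choose i)"
      by (meson dvd_trans dvd_mult2)
    then show ?thesis using True by (simp add: cong_0_iff mult_ac)
  qed simp
  ultimately have "[krawtchouk n j s = (\<Sum>i\<le>s. if i = 0 then 2 ^ (k - 2) else 0)] (mod 2 ^ (k - 1))"
    unfolding krawtchouk_expand[OF s[folded n_def]] by (intro cong_sum) auto
  then show ?thesis by (simp add: n_def j_def)
qed

section \<open>Antiperiodicity of the phases and uniform mixing\<close>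

lemma krawtchouk_middle_antiperiodic:
  assumes "k \<ge> 2" and a: "a \<in> {1, 2, 3, 4}" and s: "s + 2 \<le> 2 ^ (k + 2) - 8"
  shows "exp (- \<i> * complex_of_real (pi / 2 ^ k)
      * of_int (krawtchouk (2 ^ (k + 2) - 8) (2 ^ (k + 1) - 2 * a + 1) (s + 2)))
    = - exp (- \<i> * complex_of_real (pi / 2 ^ k)
      * of_int (krawtchouk (2 ^ (k + 2) - 8) (2 ^ (k + 1) - 2 * a + 1) s))"
proof -
  define p where "p = krawtchouk (2 ^ (k + 2) - 8) (2 ^ (k + 1) - 2 * a + 1)"
  define q where "q = krawtchouk (2 ^ (k + 2) - 10) (2 ^ (k + 1) - 2 * a) s"
  have "(2::nat) ^ (k + 2) - 8 - 2 = 2 ^ (k + 2) - 10" by simp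
  then have diff: "p s - p (s + 2) = 4 * q"
    using krawtchouk_diff[OF s, of "2 ^ (k + 1) - 2 * a + 1"] by (simp add: p_def q_def)
  have "[q = 2 ^ (k - 2)] (mod 2 ^ (k - 1))"
    unfolding q_def using assms by (intro krawtchouk_middle_cong) auto
  then obtain z where z: "q = 2 ^ (k - 2) + 2 ^ (k - 1) * z"
    by (metis cong_iff_lin cong_sym)
  obtain h where k: "k = h + 2" using assms le_Suc_ex[of 2 k] by (auto simp: add.commute)
  \<comment> \<open>4q = 2^k (2z + 1), so at time pi / 2^k the two phases differ by an odd multiple
    of pi.\<close>
  have ps: "p (s + 2) = p s - 2 ^ k * (2 * z + 1)"
    using diff z by (simp add: k algebra_simps)
  have "- \<i> * complex_of_real (pi / 2 ^ k) * of_int (p (s + 2))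
    = - \<i> * complex_of_real (pi / 2 ^ k) * of_int (p s) + (of_int (2 * z + 1) * pi) * \<i>"
    unfolding ps by (simp add: field_simps)
  then show ?thesis
    using exp_integer_2pi_plus1[of "of_int z"] unfolding p_def[symmetric]
    by (simp only: exp_add) simp
qed

theorem theorem3p8:
  fixes k :: nat
  assumes "k \<ge> 2"
    and "CARD('n::finite) = 2 ^ (k + 2) - 8"
  shows "\<forall>r \<in> {2 ^ (k + 1) - 7, 2 ^ (k + 1) - 5, 2 ^ (k + 1) - 3, 2 ^ (k + 1) - 1}.
           instantaneous_uniform_mixing
             (distance_graph r :: bool^'n \<Rightarrow> bool^'n \<Rightarrow> bool) (pi / 2 ^ k)"
proof
  fix r :: nat
  assume r: "r \<in> {2 ^ (k + 1) - 7, 2 ^ (k + 1) - 5, 2 ^ (k + 1) - 3, 2 ^ (k + 1) - 1}"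
  have k: "(8::nat) \<le> 2 ^ (k + 1)"
    using power_increasing[of 3 "k + 1" "2::nat"] assms by simp
  \<comment> \<open>\<open>a\<close> = 1, 2, 3, 4 gives the offsets 1, 3, 5, 7; the bound 8 \<le>
    2^(k+1) keeps the subtractions exact.\<close>
  obtain a where a: "a \<in> {1, 2, 3, 4}" and ra: "r = 2 ^ (k + 1) - 2 * a + 1"
  proof -
    have "\<exists>a\<in>{1, 2, 3, 4}. r = 2 ^ (k + 1) - 2 * a + 1"
      using r k by auto
    then show ?thesis using that by blast
  qed
  have n: "8 dvd CARD('n)"
    unfolding assms(2) using le_imp_power_dvd[of 3 "k + 2" "2::nat"] assms(1) by (intro dvd_diff_nat) auto
  then have even: "even CARD('n)" by (meson dvd_trans dvd_numeral_simp even_numeral)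
  define f where "f s = exp (- \<i> * complex_of_real (pi / 2 ^ k) * of_int (krawtchouk CARD('n) r s))" for s
  have "f (s + 2) = - f s" if "s + 2 \<le> CARD('n)" for s
    using krawtchouk_middle_antiperiodic[OF assms(1) a] that unfolding f_def assms(2) ra by blast
  moreover have "cmod (f s) = 1" for s by (simp add: f_def)
  ultimately have "cmod (\<Sum>w\<in>UNIV. f (weight w) * of_int (character w u * character w v))
      = 2 ^ (CARD('n) div 2)" for u v :: "bool^'n"
    using n by (intro cmod_sum_character_antiperiodic)
  then have "cmod (quantum_walk (distance_graph r) (pi / 2 ^ k) $ u $ v) = 2 ^ (CARD('n) div 2) / 2 ^ CARD('n)"
    for u v :: "bool^'n"
    by (simp only: quantum_walk_distance_graph norm_divide f_def[symmetric]) (simp add: norm_power)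
  \<comment> \<open>As \<open>CARD('n)\<close> is even, 2^(n/2) / 2^n is the reciprocal of the
    square root of the number of vertices.\<close>
  moreover have "sqrt (real CARD(bool^'n)) = 2 ^ (CARD('n) div 2)"
    by (rule real_sqrt_unique) (use even in \<open>simp_all flip: power_mult\<close>)
  moreover have "2 ^ CARD('n) = (2::real) ^ (CARD('n) div 2) * 2 ^ (CARD('n) div 2)"
    using even by (simp flip: power_add mult_2)
  ultimately show "instantaneous_uniform_mixing
      (distance_graph r :: bool^'n \<Rightarrow> bool^'n \<Rightarrow> bool) (pi / 2 ^ k)"
    by (simp add: instantaneous_uniform_mixing_def)
qed

end
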